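(* (a) For all $(a,b)\in\mathbb{R}^2$, \[ 108\,C_7(a,b)^6\le H(A_7(a,b),B_7(a,b))\le \kappa_7\,C_7(a,b)^6, \] where $\kappa_7=311\,406\,871.990\,204\ldots$ is an algebraic number, equal to the maximum of $H(A_7(a,b),B_7(a,b))$ on the ellipse $C_7(a,b)=1$. (b) Let $(a,b)$ be a $7$-groomed pair and write $C_7(a,b)=e_0^3n_0$ with $e_0,n_0$ positive integers and $n_0$ cubefree. Then $\mathrm{tmd}(A_7(a,b),B_7(a,b))=e_0e'$ for some positive integer $e'\mid 3\cdot7^3$, and \[ \frac{2^2}{3^3\cdot7^{18}}e_0^{12}n_0^6\le \mathrm{twht}(A_7(a,b),B_7(a,b))\le \kappa_7\, e_0^{12}n_0^6. \]
   Context: $A_7(a,b)=-3(a^2+ab+7b^2)(a^2-231ab+735b^2)$, $B_7(a,b)=2(a^2+ab+7b^2)(a^4+518a^3b-11025a^2b^2+6174ab^3-64827b^4)$, $C_7(a,b)=a^2+ab+7b^2$. $H(A,B)=\max(|4A^3|,|27B^2|)$. For integers $A,B$ not both zero, $\mathrm{tmd}(A,B)$ is the largest positive integer $e$ with $e^2\mid A$ and $e^3\mid B$, and $\mathrm{twht}(A,B)=H(A,B)/\mathrm{tmd}(A,B)^6$. A pair $(a,b)\in\mathbb{Z}^2$ is $7$-groomed if $\gcd(a,b)=1$, $b>0$ and $a/b\ne-7$. *)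

theory Defs
  imports "HOL-Analysis.Analysis" "HOL-Computational_Algebra.Computational_Algebra"
begin

text \<open>The forms are polymorphic because they are evaluated both at real and at integer arguments.\<close>

definition C7 :: "'a::comm_ring_1 \<Rightarrow> 'a \<Rightarrow> 'a" where
  "C7 a b = a^2 + a*b + 7*b^2"

definition A7 :: "'a::comm_ring_1 \<Rightarrow> 'a \<Rightarrow> 'a" where
  "A7 a b = -3 * (a^2 + a*b + 7*b^2) * (a^2 - 231*a*b + 735*b^2)"

definition B7 :: "'a::comm_ring_1 \<Rightarrow> 'a \<Rightarrow> 'a" where
  "B7 a b = 2 * (a^2 + a*b + 7*b^2)
     * (a^4 + 518*a^3*b - 11025*a^2*b^2 + 6174*a*b^3 - 64827*b^4)"

definition ht :: "'a::linordered_idom \<Rightarrow> 'a \<Rightarrow> 'a" where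
  "ht A B = max \<bar>4 * A^3\<bar> \<bar>27 * B^2\<bar>"

text \<open>The twist minimality defect is meaningful only if \<open>A\<close> and \<open>B\<close> are not both zero:
  for \<open>A = B = 0\<close> every positive integer qualifies and there is no greatest one.\<close>

definition tmd :: "int \<Rightarrow> int \<Rightarrow> nat" where
  "tmd A B = (GREATEST e::nat. e > 0 \<and> int e ^ 2 dvd A \<and> int e ^ 3 dvd B)"

definition twht :: "int \<Rightarrow> int \<Rightarrow> real" where
  "twht A B = real_of_int (ht A B) / real (tmd A B) ^ 6"

definition groomed7 :: "int \<Rightarrow> int \<Rightarrow> bool" where
  "groomed7 a b \<longleftrightarrow> gcd a b = 1 \<and> b > 0 \<and> real_of_int a / real_of_int b \<noteq> -7"

definition cubefree :: "nat \<Rightarrow> bool" where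
  "cubefree n \<longleftrightarrow> (\<forall>d::nat. d ^ 3 dvd n \<longrightarrow> d = 1)"

end

theory Submission
  imports Defs
begin

text \<open>
  Write \<open>A7 = -3 C7 Q7\<close> and \<open>B7 = 2 C7 R7\<close>. On the ellipse \<open>C7 = 1\<close> the bound \<open>\<bar>Q7\<bar> \<le> 141\<close> keeps
  \<open>4 \<bar>A7\<bar>^3\<close> below the value of \<open>27 B7^2\<close> near \<open>a / b = -1.2146029\<close>, so the maximum is
  attained by \<open>27 B7^2 = 108 y^2\<close> at a critical point of \<open>y = R7 / C7^2\<close>. The critical points
  are the roots of a quartic in \<open>t = a / b\<close>, and eliminating \<open>t\<close> gives a quartic equation for \<open>y\<close>.
  For the lower bound, \<open>\<bar>Q7\<bar> < C7\<close> confines \<open>t\<close> to a region where \<open>\<bar>R7\<bar> \<ge> C7^2\<close>.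

  For coprime \<open>a\<close>, \<open>b\<close>, a prime other than 2, 3, 7 never divides both \<open>A7\<close> and \<open>R7\<close>, as a
  Bezout identity between the forms shows, so its exponent in the twist minimality defect comes
  from the cube part of \<open>C7\<close>. The defect exceeds the cube part at most by \<open>7^3\<close> at 7, since \<open>7^8\<close>
  does not divide \<open>R7\<close>, and at most by 3 at 3, since \<open>3^6\<close> does not divide \<open>A7\<close> and \<open>3^4\<close>
  divides it only if \<open>3^3\<close> divides \<open>C7\<close>; at 2 it is trivial because \<open>A7\<close> is odd.
\<close>

section \<open>Factorization, positivity and homogeneity of the forms\<close>

definition Q7 :: "'a::comm_ring_1 \<Rightarrow> 'a \<Rightarrow> 'a" where
  "Q7 a b = a^2 - 231*a*b + 735*b^2"

definition R7 :: "'a::comm_ring_1 \<Rightarrow> 'a \<Rightarrow> 'a" where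
  "R7 a b = a^4 + 518*a^3*b - 11025*a^2*b^2 + 6174*a*b^3 - 64827*b^4"

lemma A7_eq: "A7 a b = -3 * C7 a b * Q7 a b"
  by (simp add: A7_def C7_def Q7_def)

lemma B7_eq: "B7 a b = 2 * C7 a b * R7 a b"
  by (simp add: B7_def C7_def R7_def)

lemma C7_scale: "C7 (r * a) (r * b) = r^2 * C7 a b"
  by (simp add: C7_def algebra_simps power2_eq_square)

lemma Q7_scale: "Q7 (r * a) (r * b) = r^2 * Q7 a b"
  by (simp add: Q7_def algebra_simps power2_eq_square)

lemma R7_scale: "R7 (r * a) (r * b) = r^4 * R7 a b"
  by (simp add: R7_def algebra_simps eval_nat_numeral)

lemma C7_sos: "4 * C7 a b = (2*a + b)^2 + 27 * b^2"
  by (simp add: C7_def algebra_simps power2_eq_square)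

lemma C7_nonneg: "C7 a b \<ge> 0" for a b :: "'a::linordered_idom"
  using C7_sos[of a b] zero_le_power2[of "2*a+b"] zero_le_power2[of b] by linarith

lemma C7_pos: "C7 a b > 0" if "a \<noteq> 0 \<or> b \<noteq> 0" for a b :: "'a::linordered_idom"
proof -
  have "(2*a + b)^2 + 27 * b^2 > 0"
  proof (cases "b = 0")
    case False
    then have "b^2 > 0" by simp
    then show ?thesis using zero_le_power2[of "2*a+b"] by linarith
  qed (use that in simp)
  then show ?thesis using C7_sos[of a b] by linarith
qed

text \<open>The two coefficients agree, \<open>4 * 3^3 = 27 * 2^2 = 108\<close>, so only
  \<open>C7^3 * abs Q7^3\<close> and \<open>C7^2 * R7^2\<close> have to be compared.\<close>

lemma ht_7: "ht (A7 a b) (B7 a b) = 108 * max (C7 a b^3 * \<bar>Q7 a b\<bar>^3) (C7 a b^2 * R7 a b^2)"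
  for a b :: "'a::linordered_idom"
proof -
  have "\<bar>4 * (-3 * C7 a b * Q7 a b)^3\<bar> = 108 * (C7 a b^3 * \<bar>Q7 a b\<bar>^3)"
    using C7_nonneg[of a b] by (simp add: abs_mult power_mult_distrib power_abs)
  moreover have "\<bar>27 * (2 * C7 a b * R7 a b)^2\<bar> = 108 * (C7 a b^2 * R7 a b^2)"
    by (simp add: abs_mult power_mult_distrib)
  ultimately show ?thesis
    by (simp add: ht_def A7_eq B7_eq max_def)
qed

lemma ht_7_scale: "ht (A7 (r * a) (r * b)) (B7 (r * a) (r * b)) = r^12 * ht (A7 a b) (B7 a b)"
  for r a b :: real
proof -
  have "C7 (r*a) (r*b)^3 * \<bar>Q7 (r*a) (r*b)\<bar>^3 = r^12 * (C7 a b^3 * \<bar>Q7 a b\<bar>^3)"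
    "C7 (r*a) (r*b)^2 * R7 (r*a) (r*b)^2 = r^12 * (C7 a b^2 * R7 a b^2)"
    by (simp_all add: C7_scale Q7_scale R7_scale abs_mult power_mult_distrib flip: power_mult)
  then show ?thesis
    by (simp add: ht_7 max_mult_distrib_left)
qed

section \<open>Lower bound for the height\<close>

text \<open>The hypothesis puts \<open>t\<close> either between 91/29 and the smaller root (about
  3.3) of \<open>t^2 - 115*t + 371\<close>, or beyond the larger root (about 111.7). In the first
  range the term \<open>-11025*t^2\<close> makes \<open>R7\<close> very negative, in the second
  \<open>518*t^3\<close> makes it large.\<close>

lemma R7_ge_if_Q7_lt:
  fixes t :: real
  assumes "\<bar>Q7 t 1\<bar> < C7 t 1"
  shows "C7 t 1^2 \<le> \<bar>R7 t 1\<bar>"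
proof -
  have "Q7 t 1 - C7 t 1 = 8 * (91 - 29 * t)" "Q7 t 1 + C7 t 1 = 2 * (t^2 - 115 * t + 371)"
    by (simp_all add: Q7_def C7_def algebra_simps)
  then have t: "91 < 29 * t" and q: "t^2 - 115 * t + 371 > 0"
    using assms by (auto simp: abs_less_iff)
  have R: "R7 t 1 = t^4 + 518*t^3 - 11025*t^2 + 6174*t - 64827"
    and C: "C7 t 1^2 = t^4 + 2*t^3 + 15*t^2 + 14*t + 49"
    by (simp_all add: R7_def C7_def algebra_simps eval_nat_numeral)
  show ?thesis
  proof (cases "t \<le> 4")
    case True
    have t3: "t^3 \<le> 4 * t^2" "t^4 \<le> 16 * t^2"
      using mult_right_mono[of t 4 "t^2"] mult_mono[of t 4 t 4] mult_right_mono[of "t*t" 16 "t^2"] True t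
      by (simp_all add: eval_nat_numeral mult_ac)
    have "t^2 \<ge> 9" using power_mono[of 3 t 2] t by simp
    have "R7 t 1 + C7 t 1^2 \<le> 0"
      using t3 \<open>t^2 \<ge> 9\<close> True unfolding R C by linarith
    then show ?thesis by linarith
  next
    case False
    have "t \<ge> 100"
    proof (rule ccontr)
      assume "\<not> t \<ge> 100"
      \<comment> \<open>The numbers 4 and 100 lie between the two roots: the quadratic in
        \<open>q\<close> equals \<open>(t - 4) * (t - 100) - (11*t + 29)\<close>.\<close>
      then have "(t - 4) * (t - 100) \<le> 0" using False by (simp add: mult_le_0_iff)
      then show False using q t False \<open>\<not> t \<ge> 100\<close> by (simp add: algebra_simps power2_eq_square)
    qed
    have "t^3 \<ge> 100 * t^2"
      using mult_right_mono[OF \<open>t \<ge> 100\<close>, of "t^2"] by (simp add: eval_nat_numeral mult_ac)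
    moreover have "t^2 \<ge> 100^2" using power_mono[of 100 t 2] \<open>t \<ge> 100\<close> by simp
    ultimately have "R7 t 1 - C7 t 1^2 \<ge> 0"
      using \<open>t \<ge> 100\<close> unfolding R C by simp
    then show ?thesis by linarith
  qed
qed

lemma ht_7_lower: "108 * C7 a b^6 \<le> ht (A7 a b) (B7 a b)" for a b :: real
proof (cases "b = 0")
  case True
  \<comment> \<open>Both sides equal \<open>108 * a^12\<close> here, so the constant 108 is
    sharp.\<close>
  then show ?thesis by (simp add: ht_7 C7_def Q7_def R7_def flip: power_mult power_add)
next
  case False
  define t where "t = a / b"
  have C: "C7 t 1 \<ge> 0" by (rule C7_nonneg)
  have "C7 t 1^6 \<le> max (C7 t 1^3 * \<bar>Q7 t 1\<bar>^3) (C7 t 1^2 * R7 t 1^2)"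
  proof (cases "\<bar>Q7 t 1\<bar> < C7 t 1")
    case True
    then have "(C7 t 1^2)^2 \<le> \<bar>R7 t 1\<bar>^2"
      using R7_ge_if_Q7_lt by (intro power_mono) auto
    then have "C7 t 1^2 * (C7 t 1^2)^2 \<le> C7 t 1^2 * R7 t 1^2"
      by (intro mult_left_mono) auto
    then show ?thesis by (simp flip: power_mult power_add)
  next
    case False
    then have "C7 t 1^3 * C7 t 1^3 \<le> C7 t 1^3 * \<bar>Q7 t 1\<bar>^3"
      using C by (intro mult_left_mono power_mono) auto
    then show ?thesis by (simp flip: power_mult power_add)
  qed
  then have "b^12 * (108 * C7 t 1^6) \<le> b^12 * ht (A7 t 1) (B7 t 1)"
    unfolding ht_7 by (intro mult_left_mono) auto
  also have "\<dots> = ht (A7 a b) (B7 a b)"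
    using ht_7_scale[of b t 1] False by (simp add: t_def)
  also have "b^12 * (108 * C7 t 1^6) = 108 * C7 a b^6"
    using C7_scale[of b t 1] False by (simp add: t_def power_mult_distrib flip: power_mult)
  finally show ?thesis .
qed

section \<open>Upper bounds for the quadratic and quartic factors\<close>

text \<open>Completing squares shows that both differences are positive definite. The integer 141 is
  the least that works, and \<open>108 * 141^3 = 302747868\<close> is below the maximum of the
  height.\<close>

lemma Q7_upper: "\<bar>Q7 a b\<bar> \<le> 141 * C7 a b" for a b :: real
proof -
  have "141 * C7 a b - Q7 a b = 140 * (a + 93/70 * b)^2 + 171/35 * b^2"
    "141 * C7 a b + Q7 a b = 142 * (a - 45/142 * b)^2 + 242499/142 * b^2"
    by (simp_all add: C7_def Q7_def algebra_simps power2_eq_square)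
  moreover have "0 \<le> 140 * (a + 93/70 * b)^2 + 171/35 * b^2"
     "0 \<le> 142 * (a - 45/142 * b)^2 + 242499/142 * b^2"
    by (intro add_nonneg_nonneg mult_nonneg_nonneg; simp)+
  ultimately show ?thesis by linarith
qed

lemma quadratic_nonneg: "a * x^2 + b * x + c \<ge> 0" if "a > 0" "b^2 \<le> 4 * a * c" for a b c x :: real
proof -
  have "4 * a * (a * x^2 + b * x + c) = (2 * a * x + b)^2 + (4 * a * c - b^2)"
    by (simp add: algebra_simps power2_eq_square)
  also have "\<dots> \<ge> 0" using that by simp
  finally show ?thesis using that by (simp add: zero_le_mult_iff)
qed

text \<open>The constant \<open>y\<close> lies just above the maximum of
  \<open>abs R7 / C7^2\<close>, with enough digits to give
  \<open>108 * y^2 < 311406871.990205\<close>.\<close>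

lemma R7_upper:
  fixes t :: real
  defines "y \<equiv> 1698.0568196830945"
  shows "\<bar>R7 t 1\<bar> \<le> y * C7 t 1^2"
proof -
  define s where "s = t + 1.2146029"
  have R: "R7 t 1 = t^4 + 518*t^3 - 11025*t^2 + 6174*t - 64827"
    and C: "C7 t 1^2 = t^4 + 2*t^3 + 15*t^2 + 14*t + 49"
    by (simp_all add: R7_def C7_def algebra_simps eval_nat_numeral)
  \<comment> \<open>Splitting 2000 off the coefficient \<open>15*y + 11025\<close> of
    \<open>t^2\<close> leaves two quadratics with negative discriminant.\<close>
  have "y * C7 t 1^2 - R7 t 1 =
      t^2 * ((y - 1) * t^2 + (2 * y - 518) * t + 2000)
      + ((15 * y + 9025) * t^2 + (14 * y - 6174) * t + (49 * y + 64827))"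
    unfolding R C by (simp add: algebra_simps eval_nat_numeral)
  also have "\<dots> \<ge> 0"
    by (intro add_nonneg_nonneg mult_nonneg_nonneg quadratic_nonneg) (simp_all add: y_def power2_eq_square)
  finally have le: "y * C7 t 1^2 - R7 t 1 \<ge> 0" .
  \<comment> \<open>Expansion around the approximate double root \<open>-1.2146029\<close>; the linear remainder is absorbed
    by splitting \<open>10000 s^2\<close> off the leading part.\<close>
  have "y * C7 t 1^2 + R7 t 1 =
      s^2 * (1699.0568196830945 * t^2 + (- 213.2450415375383213481) * t + 2457.317475387725595281751254235)
      + (10000 * s^2 + (- 0.000464462439988212210464133291042) * s + 0.00000000005408673547467529874894128930545)"
    unfolding R C y_def s_def by (simp add: field_simps eval_nat_numeral)
  also have "\<dots> \<ge> 0"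
    by (intro add_nonneg_nonneg mult_nonneg_nonneg quadratic_nonneg) (simp_all add: power2_eq_square)
  finally show ?thesis using le by linarith
qed

section \<open>Algebraicity of the critical value\<close>

lemma critical_value_poly:
  fixes t y :: real
  assumes "-43*t^4 + 1883*t^3 - 637*t^2 + 8232*t + 14406 = 0" and "R7 t 1 = y * C7 t 1^2"
  shows "2916*y^4 + 7001316*y^3 + 5059024649*y^2 + 2669391103050*y - 18312022966923 = 0"
proof -
  define C R :: "real poly" where "C = [:7, 1, 1:]" and "R = [:-64827, 6174, -11025, 518, 1:]"
  \<comment> \<open>The quartic in \<open>y\<close> is the characteristic polynomial of \<open>R / C^2\<close> modulo the quartic in \<open>t\<close>;
    \<open>S\<close> is the cofactor left after clearing denominators.\<close>
  define S :: "real poly" where "S =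
    [:-790007079969037728, -645678868911906816, -453669427891697808, -408340398058810896, -127291976045773616,
      -97740842148580064, -22753492333723088, -11072023147081904, -2326734856354832,
      -601995117211040, -94556691110000, -13319933073104, 363664321744:]"
  have "C^2 = [:49, 14, 15, 2, 1:]"
    by (simp add: C_def power2_eq_square)
  moreover have "C^4 = (C^2)^2" "C^6 = C^4 * C^2" "C^8 = (C^4)^2"
    by (simp_all flip: power_mult power_add)
  moreover have "R^4 = (R^2)^2" "R^3 = R^2 * R"
    by (simp_all add: eval_nat_numeral)
  ultimately have "smult 2916 (R^4) + smult 7001316 (R^3 * C^2) + smult 5059024649 (R^2 * C^4)
      + smult 2669391103050 (R * C^6) - smult 18312022966923 (C^8)
    = [:14406, 8232, -637, 1883, -43:] * S"
    by (simp add: R_def S_def power2_eq_square)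
  from arg_cong[OF this, of "\<lambda>p. poly p t"] have "2916 * poly R t^4
      + 7001316 * (poly R t^3 * poly C t^2) + 5059024649 * (poly R t^2 * poly C t^4)
      + 2669391103050 * (poly R t * poly C t^6) - 18312022966923 * poly C t^8
    = poly [:14406, 8232, -637, 1883, -43:] t * poly S t"
    by (simp only: poly_mult poly_add poly_diff poly_smult poly_power)
  also have "poly [:14406, 8232, -637, 1883, -43:] t = 0"
    using assms(1) by (simp add: algebra_simps eval_nat_numeral)
  finally have *: "2916 * poly R t^4
      + 7001316 * (poly R t^3 * poly C t^2) + 5059024649 * (poly R t^2 * poly C t^4)
      + 2669391103050 * (poly R t * poly C t^6) - 18312022966923 * poly C t^8 = 0"
    by simp
  have C: "poly C t = C7 t 1" and R: "poly R t = y * C7 t 1^2"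
    unfolding assms(2)[symmetric] by (simp_all add: C_def R_def C7_def R7_def algebra_simps eval_nat_numeral)
  \<comment> \<open>After the substitution \<open>R7 = y * C7^2\<close> every term contains
    \<open>C7^8\<close>, which can be cancelled.\<close>
  have "C7 t 1^8 * (2916*y^4 + 7001316*y^3 + 5059024649*y^2 + 2669391103050*y - 18312022966923) = 0"
    using * unfolding C R by (simp add: algebra_simps flip: power_mult power_add)
  then show ?thesis using C7_pos[of t 1] by simp
qed

lemma algebraic_of_critical_value:
  fixes y :: real
  assumes "2916*y^4 + 7001316*y^3 + 5059024649*y^2 + 2669391103050*y - 18312022966923 = 0"
  shows "algebraic (108 * y^2)"
proof -
  \<comment> \<open>\<open>E\<close> and \<open>O'\<close> are the even and odd parts of the quartic in \<open>y\<close>, as polynomials in \<open>108 y^2\<close>.\<close>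
  define E O' :: "real poly" where "E = [:-18312022966923, 5059024649 / 108, 2916 / 108^2:]"
    and "O' = [:2669391103050, 7001316 / 108:]"
  \<comment> \<open>At \<open>x = 108*y^2\<close> the quartic says
    \<open>E(x) = - y * O'(x)\<close>. Squaring and multiplying by 108 removes \<open>y\<close>:
    \<open>108 * E(x)^2 = x * O'(x)^2\<close>. The term \<open>E^2\<close> has degree 4 and the
    other only degree 3, so \<open>p\<close> is nonzero.\<close>
  define p where "p = 108 * E^2 - [:0, 1:] * O'^2"
  have "coeff p i \<in> \<rat>" for i
    unfolding p_def E_def O'_def by (auto simp: power2_eq_square coeff_pCons numeral_poly split: nat.splits)
  moreover have "coeff p 4 \<noteq> 0"
    by (simp add: p_def E_def O'_def power2_eq_square eval_nat_numeral numeral_poly)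
  then have "p \<noteq> 0" by auto
  moreover have "poly p (108 * y^2) = 0"
  proof -
    have E: "poly E (108*y^2) = 2916*y^4 + 5059024649*y^2 - 18312022966923"
      and O: "y * poly O' (108*y^2) = 7001316*y^3 + 2669391103050*y"
      by (simp_all add: E_def O'_def algebra_simps eval_nat_numeral)
    have "poly E (108*y^2) = - (y * poly O' (108*y^2))"
      unfolding E O using assms by simp
    then show ?thesis by (simp add: p_def numeral_poly power_mult_distrib)
  qed
  ultimately show ?thesis by (rule algebraicI')
qed

section \<open>Existence and value of the maximum on the ellipse\<close>

lemma compact_ellipse: "compact {x :: real \<times> real. C7 (fst x) (snd x) = 1}"
proof -
  have "norm x \<le> 2" if "C7 (fst x) (snd x) = 1" for x :: "real \<times> real"
  proof -
    have "2 * C7 (fst x) (snd x) = (fst x)^2 + (snd x)^2 + ((fst x + snd x)^2 + 12 * (snd x)^2)"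
      by (simp add: C7_def power2_eq_square algebra_simps)
    moreover have "(fst x + snd x)^2 + 12 * (snd x)^2 \<ge> 0" by simp
    ultimately have "(fst x)^2 + (snd x)^2 \<le> 2 * C7 (fst x) (snd x)" by linarith
    then have "(fst x)^2 + (snd x)^2 \<le> 2^2" using that by simp
    then show ?thesis by (simp add: norm_prod_def real_le_lsqrt)
  qed
  then have "bounded {x :: real \<times> real. C7 (fst x) (snd x) = 1}"
    unfolding bounded_iff by blast
  moreover have "closed {x :: real \<times> real. C7 (fst x) (snd x) = 1}"
    unfolding C7_def by (intro closed_Collect_eq continuous_intros)
  ultimately show ?thesis by (simp add: compact_eq_bounded_closed)
qed

text \<open>Dividing both arguments by \<open>sqrt (C7 a b)\<close> moves the point onto the
  ellipse; the height is homogeneous of degree 12, which produces \<open>C7^6\<close>.\<close>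

lemma ht_7_le_if_ellipse:
  fixes a b \<kappa> :: real
  assumes "\<And>a b. C7 a b = 1 \<Longrightarrow> ht (A7 a b) (B7 a b) \<le> \<kappa>"
  shows "ht (A7 a b) (B7 a b) \<le> \<kappa> * C7 a b^6"
proof (cases "a = 0 \<and> b = 0")
  case True
  then show ?thesis by (simp add: ht_7 C7_def)
next
  case False
  define c where "c = C7 a b"
  then have c: "c > 0" using C7_pos False by auto
  have r2: "(1 / sqrt c)^2 = 1 / c" using c by (simp add: power_divide)
  have r12: "(1 / sqrt c)^12 = 1 / c^6"
    using power_mult[of "1 / sqrt c" 2 6] unfolding r2 by (simp add: power_divide)
  have "ht (A7 (1 / sqrt c * a) (1 / sqrt c * b)) (B7 (1 / sqrt c * a) (1 / sqrt c * b)) \<le> \<kappa>"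
    by (rule assms) (use c in \<open>simp only: C7_scale r2; simp add: c_def\<close>)
  then show ?thesis
    unfolding ht_7_scale r12 c_def[symmetric] using c by (simp add: field_simps)
qed

text \<open>At \<open>t\<close> the nonnegative function \<open>\<kappa> * C7^4 - 108 * R7^2\<close>
  attains the value 0, hence a minimum. The resulting quartic is, up to a constant factor, the
  numerator of the derivative of \<open>R7 / C7^2\<close>.\<close>

lemma critical_point:
  fixes \<kappa> t :: real
  assumes max: "\<And>s. 108 * R7 s 1^2 \<le> \<kappa> * C7 s 1^4"
    and eq: "108 * R7 t 1^2 = \<kappa> * C7 t 1^4" and "R7 t 1 \<noteq> 0"
  shows "-43*t^4 + 1883*t^3 - 637*t^2 + 8232*t + 14406 = 0"
proof -
  let ?C' = "2 * t + 1" and ?R' = "4*t^3 + 1554*t^2 - 22050*t + 6174"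
  have "((\<lambda>s. C7 s 1) has_real_derivative ?C') (at t)"
    unfolding C7_def by (auto intro!: derivative_eq_intros)
  moreover have "((\<lambda>s. R7 s 1) has_real_derivative ?R') (at t)"
    unfolding R7_def by (auto intro!: derivative_eq_intros)
  ultimately have "((\<lambda>s. \<kappa> * C7 s 1^4 - 108 * R7 s 1^2) has_real_derivative
      \<kappa> * (4 * C7 t 1^3 * ?C') - 108 * (2 * R7 t 1 * ?R')) (at t)"
    by (auto intro!: derivative_eq_intros)
  then have "\<kappa> * (4 * C7 t 1^3 * ?C') - 108 * (2 * R7 t 1 * ?R') = 0"
    by (rule DERIV_local_min[where d = 1]) (use max eq in auto)
  \<comment> \<open>The extra factor \<open>C7\<close> completes \<open>\<kappa> * C7^4\<close>, so
    that \<open>eq\<close> eliminates \<open>\<kappa>\<close> and a factor \<open>R7\<close> splits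
    off.\<close>
  then have "0 = C7 t 1 * (\<kappa> * (4 * C7 t 1^3 * ?C') - 108 * (2 * R7 t 1 * ?R'))"
    by simp
  also have "\<dots> = 4 * (\<kappa> * C7 t 1^4) * ?C' - 216 * R7 t 1 * ?R' * C7 t 1"
    by (simp add: algebra_simps eval_nat_numeral)
  also have "\<dots> = 216 * R7 t 1 * (2 * R7 t 1 * ?C' - ?R' * C7 t 1)"
    unfolding eq[symmetric] by (simp add: algebra_simps power2_eq_square)
  finally have "2 * R7 t 1 * ?C' - ?R' * C7 t 1 = 0"
    using assms(3) by simp
  also have "2 * R7 t 1 * ?C' - ?R' * C7 t 1 = -12 * (-43*t^4 + 1883*t^3 - 637*t^2 + 8232*t + 14406)"
    by (simp add: R7_def C7_def algebra_simps eval_nat_numeral)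
  finally show ?thesis by simp
qed

lemma ht_7_maximum:
  obtains \<kappa> a b :: real
  where "algebraic \<kappa>" "311406871.990204 \<le> \<kappa>" "\<kappa> < 311406871.990205"
    and "C7 a b = 1" "ht (A7 a b) (B7 a b) = \<kappa>"
    and "\<And>a b. ht (A7 a b) (B7 a b) \<le> \<kappa> * C7 a b^6"
proof -
  let ?S = "{x :: real \<times> real. C7 (fst x) (snd x) = 1}"
  let ?H = "\<lambda>x :: real \<times> real. ht (A7 (fst x) (snd x)) (B7 (fst x) (snd x))"
  have "(1, 0) \<in> ?S" by (simp add: C7_def)
  moreover have "continuous_on ?S ?H"
    unfolding ht_7 C7_def Q7_def R7_def by (intro continuous_intros)
  ultimately obtain x where x: "x \<in> ?S" "\<forall>y\<in>?S. ?H y \<le> ?H x"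
    using continuous_attains_sup[OF compact_ellipse] by blast
  define a b \<kappa> where "a = fst x" and "b = snd x" and "\<kappa> = ?H x"
  have C: "C7 a b = 1" and H: "ht (A7 a b) (B7 a b) = \<kappa>"
    using x by (auto simp: a_def b_def \<kappa>_def)
  have le: "ht (A7 a b) (B7 a b) \<le> \<kappa> * C7 a b^6" for a b
    by (rule ht_7_le_if_ellipse) (use x in \<open>force simp: \<kappa>_def\<close>)
  have lower: "311406871.990204 \<le> \<kappa>"
  proof -
    \<comment> \<open>A decimal approximation to the maximizing root of the critical quartic; it
      suffices for the stated digits.\<close>
    let ?\<tau> = "-1.2146029 :: real"
    have "311406871.990204 * C7 ?\<tau> 1^6 \<le> 108 * (C7 ?\<tau> 1^2 * R7 ?\<tau> 1^2)"
      by (simp add: C7_def R7_def field_simps)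
    also have "\<dots> \<le> ht (A7 ?\<tau> 1) (B7 ?\<tau> 1)" unfolding ht_7 by simp
    also have "\<dots> \<le> \<kappa> * C7 ?\<tau> 1^6" by (rule le)
    finally show ?thesis using C7_pos[of ?\<tau> 1] by simp
  qed
  \<comment> \<open>On the axis \<open>b = 0\<close> the height is only 108. Excluding it allows the
    passage to the affine coordinate \<open>t = a / b\<close>.\<close>
  have "b \<noteq> 0"
  proof
    assume "b = 0"
    then have "a^2 = 1" using C by (simp add: C7_def)
    then have "\<kappa> = 108"
      unfolding H[symmetric] ht_7 C using \<open>b = 0\<close> power_mult[of a 2 2] by (simp add: Q7_def R7_def)
    then show False using lower by simp
  qed
  define t where "t = a / b"
  define c where "c = C7 t 1"
  have c: "c > 0" unfolding c_def by (rule C7_pos) simp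
  have "b^2 * c = 1" using C7_scale[of b t 1] C \<open>b \<noteq> 0\<close> by (simp add: t_def c_def)
  then have bc: "b^12 * c^6 = 1"
    using power_mult_distrib[of "b^2" c 6] by (simp flip: power_mult)
  have "b^12 * ht (A7 t 1) (B7 t 1) = \<kappa>"
    using ht_7_scale[of b t 1] H \<open>b \<noteq> 0\<close> by (simp add: t_def)
  then have "b^12 * ht (A7 t 1) (B7 t 1) = b^12 * (\<kappa> * c^6)"
    using bc by (simp add: algebra_simps)
  then have Ht: "ht (A7 t 1) (B7 t 1) = \<kappa> * c^6" using \<open>b \<noteq> 0\<close> by simp
  \<comment> \<open>The \<open>A7\<close> term is too small to give the maximum, so the height at
    \<open>t\<close> equals the differentiable \<open>B7\<close> term.\<close>
  have "\<bar>Q7 t 1\<bar>^3 \<le> (141 * c)^3"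
    using Q7_upper[of t 1] by (intro power_mono) (auto simp: c_def)
  then have "108 * (c^3 * \<bar>Q7 t 1\<bar>^3) \<le> 108 * (c^3 * (141 * c)^3)"
    using c by (intro mult_left_mono) auto
  also have "\<dots> = 302747868 * c^6"
    by (simp add: power_mult_distrib flip: power_add)
  also have "\<dots> < \<kappa> * c^6" using lower c by simp
  finally have "\<kappa> * c^6 = 108 * (c^2 * R7 t 1^2)"
    using Ht unfolding ht_7 c_def[symmetric] by (simp add: max_def split: if_splits)
  then have "c^2 * (108 * R7 t 1^2) = \<kappa> * (c^2 * c^4)"
    by (simp only: mult.left_commute flip: power_add) simp
  then have "c^2 * (108 * R7 t 1^2) = c^2 * (\<kappa> * c^4)"
    by (simp only: mult.left_commute)
  then have eq: "108 * R7 t 1^2 = \<kappa> * c^4" using c by simp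
  have le': "108 * R7 s 1^2 \<le> \<kappa> * C7 s 1^4" for s
  proof -
    have "C7 s 1 > 0" by (rule C7_pos) simp
    have "108 * (C7 s 1^2 * R7 s 1^2) \<le> ht (A7 s 1) (B7 s 1)" unfolding ht_7 by simp
    also have "\<dots> \<le> \<kappa> * C7 s 1^6" by (rule le)
    finally have "C7 s 1^2 * (108 * R7 s 1^2) \<le> C7 s 1^2 * (\<kappa> * C7 s 1^4)"
      by (simp add: algebra_simps flip: power_add)
    then show ?thesis using \<open>C7 s 1 > 0\<close> by simp
  qed
  have "R7 t 1 \<noteq> 0" using eq c lower by auto
  then have crit: "-43*t^4 + 1883*t^3 - 637*t^2 + 8232*t + 14406 = 0"
    using critical_point[OF le', of t] eq by (simp add: c_def)
  define y where "y = R7 t 1 / c^2"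
  have \<kappa>: "\<kappa> = 108 * y^2"
    using eq c by (simp add: y_def field_simps flip: power_mult)
  have "R7 t 1 = y * c^2" using c by (simp add: y_def)
  then have "algebraic \<kappa>"
    unfolding \<kappa> using critical_value_poly[OF crit] by (intro algebraic_of_critical_value) (simp add: c_def)
  moreover have "\<kappa> < 311406871.990205"
  proof -
    have "\<bar>y\<bar> \<le> 1698.0568196830945"
      using R7_upper[of t] c by (simp add: y_def c_def field_simps)
    then have "\<bar>y\<bar>^2 \<le> 1698.0568196830945^2" by (intro power_mono) auto
    then show ?thesis unfolding \<kappa> by (simp add: power2_eq_square)
  qed
  ultimately show ?thesis using that lower C H le by blast
qed

section \<open>Divisibility of the forms at coprime arguments\<close>

text \<open>Eliminating \<open>a\<close> between two quartic forms takes cubic cofactors and leaves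
  a multiple of \<open>b^7\<close>. What matters is that the constant has no prime factors besides
  2, 3 and 7; together with the companion identity for \<open>a^7\<close> this controls common
  primes.\<close>

lemma resultant_b: "A7 a b * (-76526730*b^3 + 16668918*a*b^2 - 612822*a^2*b - 1196*a^3)
  + 2 * R7 a b * (3463173*b^3 - 3216339*a*b^2 + 422679*a^2*b - 1794*a^3) = 2^5*3^4*7^10 * b^7"
  unfolding A7_def R7_def by (simp add: algebra_simps eval_nat_numeral)

lemma resultant_a: "A7 a b * (27820044*b^3 - 2493414*a*b^2 + 4720590*a^2*b - 198626*a^3)
  + 2 * R7 a b * (-3311910*b^3 + 549171*a*b^2 - 326247*a^2*b + 146589*a^3) = 2^5*3^4*7^3 * a^7"
  unfolding A7_def R7_def by (simp add: algebra_simps eval_nat_numeral)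

lemma prime_not_dvd_both:
  fixes a b p :: int
  assumes "coprime a b" "prime p" "p dvd a"
  shows "\<not> p dvd b"
  using assms coprime_common_divisor not_prime_unit by blast

text \<open>Modulo 2 both quadratic factors become \<open>a^2 + a*b + b^2\<close>, which is even
  only if \<open>a\<close> and \<open>b\<close> are.\<close>

lemma odd_A7:
  fixes a b :: int
  assumes "coprime a b"
  shows "odd (A7 a b)"
  using prime_not_dvd_both[OF assms, of 2] by (auto simp: A7_def)

lemma prime_dvd_A7_R7:
  fixes a b p :: int
  assumes "coprime a b" "prime p" "p dvd A7 a b" "p dvd R7 a b"
  shows "p = 2 \<or> p = 3 \<or> p = 7"
proof (rule ccontr)
  assume np: "\<not> ?thesis"
  have "p dvd 2^5*3^4*7^10 * b^7" "p dvd 2^5*3^4*7^3 * a^7"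
    unfolding resultant_a[of a b, symmetric] resultant_b[of a b, symmetric] using assms(3,4) by simp_all
  moreover have "\<not> p dvd 2" "\<not> p dvd 3" "\<not> p dvd 7"
    using np \<open>prime p\<close> primes_dvd_imp_eq[of p "2::int"] primes_dvd_imp_eq[of p "3::int"] primes_dvd_imp_eq[of p "7::int"]
    by auto
  ultimately have "p dvd b" "p dvd a"
    using \<open>prime p\<close> unfolding prime_dvd_mult_iff[OF \<open>prime p\<close>]
    by (metis prime_dvd_power)+
  then show False using prime_not_dvd_both assms(1,2) by blast
qed

text \<open>The divisibility forces first \<open>a = 7*c\<close>, which extracts \<open>7^4\<close>,
  and then \<open>c = 7*m - b\<close>, which extracts \<open>7^7\<close> in all. The remaining
  factor is \<open>- b^4\<close> modulo 7, and 7 does not divide \<open>b\<close>.\<close>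

lemma not_7_pow_8_dvd_R7:
  fixes a b :: int
  assumes "coprime a b"
  shows "\<not> 7^8 dvd R7 a b"
proof
  assume dvd: "7^8 dvd R7 a b"
  have "R7 a b = a^4 + 7 * (74*a^3*b - 1575*a^2*b^2 + 882*a*b^3 - 9261*b^4)"
    by (simp add: R7_def algebra_simps)
  moreover have "7 dvd R7 a b" using dvd by (rule dvd_trans[rotated]) simp
  ultimately have "7 dvd a^4" by (metis dvd_add_left_iff dvd_triv_left)
  then have "7 dvd a" by (rule prime_dvd_power[rotated]) simp
  then obtain c where c: "a = 7 * c" by auto
  have "\<not> 7 dvd b" using prime_not_dvd_both[OF assms _ \<open>7 dvd a\<close>] by simp
  have R: "R7 a b = 7^4 * ((c + b)^4 + 7 * (10*c^3*b - 33*c^2*b^2 + 2*c*b^3 - 4*b^4))"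
    unfolding c by (simp add: R7_def algebra_simps eval_nat_numeral)
  have "7^4 * 7^4 dvd R7 a b" using dvd by simp
  then have "7^4 dvd (c + b)^4 + 7 * (10*c^3*b - 33*c^2*b^2 + 2*c*b^3 - 4*b^4)"
    unfolding R by (subst (asm) dvd_mult_cancel_left) simp
  then have "7 dvd (c + b)^4 + 7 * (10*c^3*b - 33*c^2*b^2 + 2*c*b^3 - 4*b^4)"
    by (rule dvd_trans[rotated]) simp
  then have "7 dvd (c + b)^4" by (metis dvd_add_left_iff dvd_triv_left)
  then have "7 dvd c + b" by (rule prime_dvd_power[rotated]) simp
  then obtain m where m: "c + b = 7 * m" by auto
  then have "c = 7 * m - b" by simp
  then have "R7 a b = 7^7 * (7 * (m^4 + 10*m^3*b - 9*m^2*b^2 + 2*m*b^3) - b^4)"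
    unfolding c \<open>c = 7 * m - b\<close> by (simp add: R7_def algebra_simps eval_nat_numeral)
  moreover have "7^7 * 7 dvd R7 a b" using dvd by simp
  ultimately have "7 dvd 7 * (m^4 + 10*m^3*b - 9*m^2*b^2 + 2*m*b^3) - b^4"
    by (simp only: dvd_mult_cancel_left) simp
  moreover have "7 dvd z" if "7 dvd 7 * w - z" for w z :: int
    using that by presburger
  ultimately have "7 dvd b^4" by metis
  then show False using \<open>\<not> 7 dvd b\<close> prime_dvd_power[of 7 b 4] by simp
qed

text \<open>Modulo 3, \<open>C7\<close> is \<open>(a - b)^2\<close> and \<open>Q7\<close> is
  \<open>a^2\<close>, so \<open>a\<close> and \<open>b\<close> are congruent and nonzero. With
  \<open>a = b + 3*k\<close> one gets \<open>C7 = 9 * (k^2 + k*b + b^2)\<close>, whose second factor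
  has the same shape modulo 3.\<close>

lemma C7_3_adic:
  fixes a b :: int
  assumes "coprime a b" "3 dvd C7 a b"
  shows "\<not> 3 dvd Q7 a b" "\<not> 81 dvd C7 a b"
proof -
  have "C7 a b = (a - b)^2 + 3 * (a * b + 2 * b^2)"
    by (simp add: C7_def power2_eq_square algebra_simps)
  then have "3 dvd (a - b)^2" using assms(2) by (metis dvd_add_left_iff dvd_triv_left)
  then have ab: "3 dvd a - b" by (rule prime_dvd_power[rotated]) simp
  have na: "\<not> 3 dvd a"
  proof
    assume "3 dvd a"
    moreover from this ab have "3 dvd b" using dvd_diff[of 3 a "a - b"] by simp
    ultimately show False using prime_not_dvd_both[OF assms(1), of 3] by simp
  qed
  show "\<not> 3 dvd Q7 a b"
  proof
    assume "3 dvd Q7 a b"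
    moreover have "Q7 a b = a^2 + 3 * (245*b^2 - 77*a*b)" by (simp add: Q7_def algebra_simps)
    ultimately have "3 dvd a^2" by (metis dvd_add_left_iff dvd_triv_left)
    then show False using na prime_dvd_power[of 3 a 2] by simp
  qed
  show "\<not> 81 dvd C7 a b"
  proof
    assume dvd: "81 dvd C7 a b"
    obtain k where "a - b = 3 * k" using ab by auto
    then have a: "a = b + 3 * k" by simp
    have "C7 a b = 9 * ((k - b)^2 + 3 * (k * b))"
      unfolding a by (simp add: C7_def power2_eq_square algebra_simps)
    moreover have "9 dvd z" if "81 dvd 9 * z" for z :: int
      using that by presburger
    ultimately have dvd9: "9 dvd (k - b)^2 + 3 * (k * b)" using dvd by metis
    have "3 dvd (k - b)^2 + 3 * (k * b)" by (rule dvd_trans[OF _ dvd9]) simp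
    then have "3 dvd (k - b)^2" by (metis dvd_add_left_iff dvd_triv_left)
    then have "3 dvd k - b" by (rule prime_dvd_power[rotated]) simp
    then obtain j where "k - b = 3 * j" by auto
    then have k: "k = b + 3 * j" by simp
    \<comment> \<open>Only \<open>3 * b^2\<close> survives modulo 9, so this factor contains 3
      exactly once.\<close>
    have "(k - b)^2 + 3 * (k * b) = 9 * (j^2 + j * b) + 3 * b^2"
      unfolding k by (simp add: power2_eq_square algebra_simps)
    moreover have "3 dvd z" if "9 dvd 9 * w + 3 * z" for w z :: int
      using that by presburger
    ultimately have "3 dvd b^2" using dvd9 by metis
    then have "3 dvd b" by (rule prime_dvd_power[rotated]) simp
    then show False using na a by simp
  qed
qed

text \<open>Since \<open>A7 = -3 * C7 * Q7\<close>, one power of 3 is lost. The others must all sit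
  in \<open>C7\<close>: if 3 divides \<open>C7\<close> it does not divide \<open>Q7\<close>, and
  \<open>Q7\<close> is never divisible by 9.\<close>

lemma A7_3_adic:
  fixes a b :: int
  assumes "coprime a b"
  shows "\<not> 3^6 dvd A7 a b" and "3^4 dvd A7 a b \<Longrightarrow> 3^3 dvd C7 a b"
proof -
  have nQ: "\<not> 9 dvd Q7 a b"
  proof
    assume dvd: "9 dvd Q7 a b"
    have Q: "Q7 a b = a^2 + 3 * (245*b^2 - 77*a*b)" by (simp add: Q7_def algebra_simps)
    have "3 dvd Q7 a b" by (rule dvd_trans[OF _ dvd]) simp
    then have "3 dvd a^2" unfolding Q by (metis dvd_add_left_iff dvd_triv_left)
    then have "3 dvd a" by (rule prime_dvd_power[rotated]) simp
    then obtain c where c: "a = 3 * c" by auto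
    have "\<not> 3 dvd b" using prime_not_dvd_both[OF assms _ \<open>3 dvd a\<close>] by simp
    \<comment> \<open>Here \<open>735 = 9 * 81 + 6\<close>, so divisibility by 9 would force 3 to
      divide \<open>b\<close>.\<close>
    have "Q7 a b = 9 * (c^2 - 77*c*b + 81 * b^2) + 6 * b^2"
      unfolding c by (simp add: Q7_def power2_eq_square algebra_simps)
    moreover have "3 dvd z" if "9 dvd 9 * w + 6 * z" for w z :: int
      using that by presburger
    ultimately have "3 dvd b^2" using dvd by metis
    then show False using \<open>\<not> 3 dvd b\<close> prime_dvd_power[of 3 b 2] by simp
  qed
  have key: "3^Suc n dvd A7 a b \<Longrightarrow> n \<ge> 2 \<Longrightarrow> 3^n dvd C7 a b" for n
  proof -
    assume A: "3^Suc n dvd A7 a b" and "n \<ge> 2"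
    have "A7 a b = 3 * (- (C7 a b * Q7 a b))" by (simp add: A7_eq)
    with A have CQ: "3^n dvd C7 a b * Q7 a b" by (simp only: power_Suc) simp
    show "3^n dvd C7 a b"
    proof (cases "3 dvd C7 a b")
      case True
      then have "coprime (3^n) (Q7 a b)"
        using C7_3_adic(1)[OF assms] by (simp add: prime_imp_coprime)
      then show ?thesis using CQ by (simp add: coprime_dvd_mult_left_iff)
    next
      case False
      then have "coprime (3^n) (C7 a b)" by (simp add: prime_imp_coprime)
      then have "3^n dvd Q7 a b" using CQ by (simp add: coprime_dvd_mult_right_iff)
      then have "3^2 dvd Q7 a b" using \<open>n \<ge> 2\<close> by (rule power_le_dvd)
      then show ?thesis using nQ by simp
    qed
  qed
  show "3^4 dvd A7 a b \<Longrightarrow> 3^3 dvd C7 a b" using key[of 3] by simp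
  show "\<not> 3^6 dvd A7 a b"
  proof
    assume "3^6 dvd A7 a b"
    then have "3^5 dvd C7 a b" using key[of 5] by simp
    then have "3^4 dvd C7 a b" "3^1 dvd C7 a b" by (rule power_le_dvd, simp)+
    then show False using C7_3_adic(2)[OF assms] by simp
  qed
qed

section \<open>The twist minimality defect\<close>

text \<open>The cubefree part contributes less than 3 to the exponent of \<open>p\<close>, so
  \<open>3*k < 3 * multiplicity p e + 3\<close>.\<close>

lemma cubefree_prime_power_dvd:
  fixes p k e n :: nat
  assumes "prime p" "cubefree n" "n > 0" "e > 0" "p^(3*k) dvd e^3 * n"
  shows "p^k dvd e"
proof -
  have "multiplicity p n < 3"
  proof (rule ccontr)
    assume "\<not> ?thesis"
    then have "p^3 dvd n" using multiplicity_dvd'[of 3 p n] by simp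
    then show False using assms(1,2) by (auto simp: cubefree_def)
  qed
  moreover have "3 * k \<le> multiplicity p (e^3 * n)"
    using assms by (intro multiplicity_geI) auto
  moreover have "multiplicity p (e^3 * n) = 3 * multiplicity p e + multiplicity p n"
    using assms by (simp add: prime_elem_multiplicity_mult_distrib prime_elem_multiplicity_power_distrib)
  ultimately have "k \<le> multiplicity p e" by linarith
  then show ?thesis by (rule multiplicity_dvd')
qed

text \<open>The exponents are compared prime by prime. Outside 2, 3, 7 the whole power
  \<open>p^(3*k)\<close> falls into \<open>C7\<close>, hence \<open>p^k\<close> into
  \<open>e\<^sub>0\<close>; the factor \<open>3 * 7^3\<close> absorbs the excess at 3 and 7.\<close>

lemma twist_divisor_bound:
  fixes a b :: int and e e\<^sub>0 n\<^sub>0 :: nat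
  assumes co: "coprime a b" and n: "cubefree n\<^sub>0" "n\<^sub>0 > 0" "e\<^sub>0 > 0"
    and C: "C7 a b = int e\<^sub>0 ^ 3 * int n\<^sub>0"
    and e: "e > 0" "int e^2 dvd A7 a b" "int e^3 dvd B7 a b"
  shows "e dvd e\<^sub>0 * (3 * 7^3)"
proof (rule multiplicity_le_imp_dvd)
  show "e \<noteq> 0" using e by simp
next
  fix p :: nat assume p: "prime p"
  define k where "k = multiplicity p e"
  have "p^k dvd e" by (simp add: k_def multiplicity_dvd)
  then have pe: "int p^k dvd int e" by (metis of_nat_dvd_iff of_nat_power)
  have pA: "int p^(2*k) dvd A7 a b"
    using dvd_trans[OF dvd_power_same[OF pe, of 2] e(2)] by (simp add: mult.commute flip: power_mult)
  have pB: "int p^(3*k) dvd 2 * C7 a b * R7 a b"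
    using dvd_trans[OF dvd_power_same[OF pe, of 3] e(3)] by (simp add: B7_eq mult.commute flip: power_mult)
  have p_e0: "p^j dvd e\<^sub>0" if "int p^(3*j) dvd C7 a b" for j
  proof (rule cubefree_prime_power_dvd[OF p n])
    have "int (p^(3*j)) dvd int (e\<^sub>0^3 * n\<^sub>0)" using that C by simp
    then show "p^(3*j) dvd e\<^sub>0^3 * n\<^sub>0" by (simp only: of_nat_dvd_iff)
  qed
  have pA1: "int p dvd A7 a b" if "k > 0"
    using power_le_dvd[OF pA, of 1] that by simp
  have "p^k dvd e\<^sub>0 * (3 * 7^3)"
  proof (cases "k = 0")
    case False
    then have k: "k > 0" by simp
    consider "p = 2" | "p = 3" | "p = 7" | "p \<noteq> 2" "p \<noteq> 3" "p \<noteq> 7" by blast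
    then show ?thesis
    proof cases
      case 1
      then show ?thesis using pA1[OF k] odd_A7[OF co] by simp
    next
      case 2
      \<comment> \<open>The power \<open>3^(2*k)\<close> divides \<open>A7\<close>, which rules out
        \<open>k = 3\<close>. For \<open>k = 2\<close> it gives \<open>3^3 dvd C7\<close>, so
        \<open>e\<^sub>0\<close> supplies one factor 3 and the constant the other.\<close>
      have "\<not> k \<ge> 3"
      proof
        assume "k \<ge> 3"
        then have "int p^6 dvd A7 a b" using power_le_dvd[OF pA, of 6] by simp
        then show False using A7_3_adic(1)[OF co] 2 by simp
      qed
      then consider "k = 1" | "k = 2" using k by linarith
      then show ?thesis
      proof cases
        case 2
        then have "p^1 dvd e\<^sub>0" using A7_3_adic(2)[OF co] pA \<open>p = 3\<close> by (intro p_e0) simp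
        then show ?thesis using \<open>k = 2\<close> \<open>p = 3\<close> by (auto simp: power2_eq_square)
      qed (use \<open>p = 3\<close> in simp)
    next
      case 3
      have "\<not> 7^8 dvd 2 * R7 a b"
        using not_7_pow_8_dvd_R7[OF co] coprime_dvd_mult_right_iff[of "7^8" "2::int"] by simp
      \<comment> \<open>The exponents add up to \<open>3*k + 1\<close>, one more than the power
        dividing the product; \<open>k \<ge> 3\<close> keeps the subtraction from
        truncating.\<close>
      moreover have "7^(3*k-7) dvd C7 a b \<or> 7^8 dvd 2 * R7 a b" if "k \<ge> 3"
        using pB 3 that by (intro prime_elem_power_dvd_cases[where c = "3*k"]) (simp_all add: mult_ac)
      ultimately have le: "k \<ge> 3 \<Longrightarrow> 7^(3*k-7) dvd C7 a b" by blast
      \<comment> \<open>The exponent \<open>3*k - 7\<close> is rounded down to a multiple of 3. For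
        \<open>k < 3\<close> truncated subtraction gives exponent 0 and the claim is
        trivial.\<close>
      have "7^(3*(k-3)) dvd C7 a b"
        using power_le_dvd[OF le, of "3*(k-3)"] by (cases "k \<ge> 3") simp_all
      then have "p^(k-3) dvd e\<^sub>0" using 3 by (intro p_e0) simp
      then have "p^(k-3) * p^3 dvd e\<^sub>0 * (3 * 7^3)" using 3 by (intro mult_dvd_mono) auto
      moreover have "p^k dvd p^(k-3) * p^3" by (simp add: le_imp_power_dvd flip: power_add)
      ultimately show ?thesis by (rule dvd_trans[rotated])
    next
      case 4
      have pi: "prime (int p)" using p by simp
      have "\<not> int p dvd R7 a b"
        using prime_dvd_A7_R7[OF co pi pA1[OF k]] 4 by auto
      moreover have "\<not> int p dvd 2"
        using primes_dvd_imp_eq[OF pi, of 2] 4 by auto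
      ultimately have "\<not> int p dvd 2 * R7 a b" using pi by (simp add: prime_dvd_mult_iff)
      then have "coprime (int p) (2 * R7 a b)" using pi by (intro prime_imp_coprime)
      then have "coprime (int p^(3*k)) (2 * R7 a b)" by (simp only: coprime_power_left_iff) simp
      then have "int p^(3*k) dvd C7 a b" using pB
        by (simp only: mult.commute[of 2] mult.assoc coprime_dvd_mult_left_iff)
      then show ?thesis using p_e0 by simp
    qed
  qed simp
  then show "multiplicity p e \<le> multiplicity p (e\<^sub>0 * (3 * 7^3))"
    using p n k_def by (intro multiplicity_geI) auto
qed

text \<open>Once the power of the gcd is divided out, the two cofactors are coprime and their powers
  multiply.\<close>

lemma lcm_power_dvd:
  fixes e f :: nat and x :: int
  assumes "e > 0" "int e^n dvd x" "int f^n dvd x"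
  shows "int (lcm e f)^n dvd x"
proof -
  define g where "g = gcd e f"
  have g: "g > 0" unfolding g_def using assms(1) by simp
  then have "gcd e f \<noteq> 0" by (simp only: g_def)
  from gcd_coprime_exists[OF this]
  obtain e' f' where e: "e = e' * g" and f: "f = f' * g" and co: "coprime e' f'"
    unfolding g_def by blast
  have "g * lcm e f = e * f" unfolding g_def by (rule prod_gcd_lcm_nat[symmetric])
  also have "\<dots> = g * (e' * f' * g)" unfolding e f by (simp add: mult_ac)
  finally have l: "lcm e f = e' * f' * g" using g by simp
  have "int g^n dvd int e^n" by (simp add: e dvd_power_same)
  then have "int g^n dvd x" using assms(2) by (rule dvd_trans)
  then obtain y where y: "x = int g^n * y" by auto
  have "int g^n * int e'^n dvd int g^n * y" "int g^n * int f'^n dvd int g^n * y"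
    using assms(2,3) unfolding y e f by (simp_all add: power_mult_distrib mult.commute)
  then have "int e'^n dvd y" "int f'^n dvd y" using g by simp_all
  moreover have "coprime (int e'^n) (int f'^n)" using co by simp
  ultimately have "int e'^n * int f'^n dvd y" by (rule divides_mult)
  then show ?thesis
    unfolding l y by (simp add: power_mult_distrib mult.commute mult_dvd_mono)
qed

text \<open>The bound \<open>N\<close> ensures that a greatest admissible \<open>e\<close> exists.
  Admissible numbers are closed under lcm, so the numerically greatest one is also a multiple of
  every other.\<close>

lemma tmd_between:
  fixes A B :: int and d N :: nat
  assumes bound: "\<And>e. e > 0 \<Longrightarrow> int e^2 dvd A \<Longrightarrow> int e^3 dvd B \<Longrightarrow> e dvd N"
    and "N > 0"
    and d: "d > 0" "int d^2 dvd A" "int d^3 dvd B"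
  shows "d dvd tmd A B" "tmd A B dvd N"
proof -
  let ?P = "\<lambda>e::nat. e > 0 \<and> int e^2 dvd A \<and> int e^3 dvd B"
  have le: "e \<le> N" if "?P e" for e
    using bound[of e] that \<open>N > 0\<close> by (auto intro: dvd_imp_le)
  have P: "?P (tmd A B)"
    unfolding tmd_def by (rule GreatestI_nat[of ?P d N]) (use d le in auto)
  then show "tmd A B dvd N" using bound by blast
  have "?P (lcm d (tmd A B))"
    using P d by (auto intro!: lcm_power_dvd lcm_pos_nat)
  then have "lcm d (tmd A B) \<le> tmd A B"
    unfolding tmd_def by (rule Greatest_le_nat[where P = ?P and b = N]) (use le in auto)
  moreover have "tmd A B \<le> lcm d (tmd A B)"
    using P d by (intro dvd_imp_le) (auto intro: lcm_pos_nat)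
  ultimately have "lcm d (tmd A B) = tmd A B" by simp
  then show "d dvd tmd A B" by (metis dvd_lcm1)
qed

lemma tmd_7:
  fixes a b :: int and e\<^sub>0 n\<^sub>0 :: nat
  assumes "coprime a b" "cubefree n\<^sub>0" "n\<^sub>0 > 0" "e\<^sub>0 > 0"
    and C: "C7 a b = int e\<^sub>0 ^ 3 * int n\<^sub>0"
  obtains e' where "e' > 0" "e' dvd 3 * 7^3" "tmd (A7 a b) (B7 a b) = e\<^sub>0 * e'"
proof -
  have "int e\<^sub>0^2 dvd A7 a b" "int e\<^sub>0^3 dvd B7 a b"
    unfolding A7_eq B7_eq C by (simp_all add: eval_nat_numeral)
  then have "e\<^sub>0 dvd tmd (A7 a b) (B7 a b)" "tmd (A7 a b) (B7 a b) dvd e\<^sub>0 * (3 * 7^3)"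
    using tmd_between[OF twist_divisor_bound[OF assms]] \<open>e\<^sub>0 > 0\<close> by simp_all
  moreover from this(1) obtain e' where e': "tmd (A7 a b) (B7 a b) = e\<^sub>0 * e'" by (rule dvdE)
  ultimately have "e' dvd 3 * 7^3" using \<open>e\<^sub>0 > 0\<close> by simp
  moreover from this have "e' > 0" by (intro gr0I) auto
  ultimately show ?thesis using that e' by blast
qed

lemma of_int_ht_7: "of_int (ht (A7 a b) (B7 a b)) = ht (A7 (of_int a) (of_int b)) (B7 (of_int a) (of_int b) :: real)"
  by (simp add: ht_7 C7_def Q7_def R7_def of_int_max)

lemma of_int_C7: "of_int (C7 a b) = C7 (of_int a) (of_int b)"
  by (simp add: C7_def)

text \<open>Here \<open>C7^6 = e\<^sub>0^18 * n\<^sub>0^6\<close>, and division by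
  \<open>(e\<^sub>0 * e')^6\<close> leaves \<open>e\<^sub>0^12 * n\<^sub>0^6 / e'^6\<close>. The
  bounds follow from \<open>1 \<le> e' \<le> 3 * 7^3\<close> and
  \<open>108 / (3 * 7^3)^6 = 4 / (3^3 * 7^18)\<close>.\<close>

lemma twht_7_bounds:
  fixes a b :: int and e\<^sub>0 n\<^sub>0 e' :: nat and \<kappa> :: real
  assumes le: "\<And>a b :: real. ht (A7 a b) (B7 a b) \<le> \<kappa> * C7 a b^6"
    and ge: "\<And>a b :: real. 108 * C7 a b^6 \<le> ht (A7 a b) (B7 a b)"
    and "\<kappa> \<ge> 0" "e\<^sub>0 > 0" and C: "C7 a b = int e\<^sub>0 ^ 3 * int n\<^sub>0"
    and e': "e' > 0" "e' dvd 3 * 7^3" "tmd (A7 a b) (B7 a b) = e\<^sub>0 * e'"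
  shows "2^2 / (3^3 * 7^18) * real e\<^sub>0^12 * real n\<^sub>0^6 \<le> twht (A7 a b) (B7 a b)"
    and "twht (A7 a b) (B7 a b) \<le> \<kappa> * real e\<^sub>0^12 * real n\<^sub>0^6"
proof -
  define x where "x = real e\<^sub>0^12 * real n\<^sub>0^6"
  have x: "x \<ge> 0" by (simp add: x_def)
  have C': "C7 (real_of_int a) (real_of_int b)^6 = real e\<^sub>0^6 * x"
    unfolding of_int_C7[symmetric] C x_def
    by (simp add: power_mult_distrib flip: power_mult power_add mult.assoc)
  define h where "h = ht (A7 (real_of_int a) (real_of_int b)) (B7 (real_of_int a) (real_of_int b))"
  have h: "108 * (real e\<^sub>0^6 * x) \<le> h" "h \<le> \<kappa> * (real e\<^sub>0^6 * x)"
    using le[of "real_of_int a" "real_of_int b"] ge[of "real_of_int a" "real_of_int b"]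
    unfolding C' h_def by auto
  have t: "twht (A7 a b) (B7 a b) = h / (real e\<^sub>0^6 * real e'^6)"
    unfolding twht_def e'(3) of_int_ht_7 h_def by (simp add: power_mult_distrib)
  have "e' \<le> 3 * 7^3" using e' by (intro dvd_imp_le) auto
  then have "real e' \<le> real (3 * 7^3)" by (simp only: of_nat_le_iff)
  then have e6: "real e'^6 \<le> real (3 * 7^3)^6" by (intro power_mono) auto
  have "1 \<le> real e'^6" using e'(1) by simp
  then have "\<kappa> * (real e\<^sub>0^6 * x) * 1 \<le> \<kappa> * (real e\<^sub>0^6 * x) * real e'^6"
    using \<open>\<kappa> \<ge> 0\<close> x by (intro mult_left_mono) auto
  with h(2) have "h \<le> \<kappa> * (real e\<^sub>0^6 * x) * real e'^6" by linarith
  then show "twht (A7 a b) (B7 a b) \<le> \<kappa> * real e\<^sub>0^12 * real n\<^sub>0^6"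
    unfolding t mult.assoc x_def[symmetric] using \<open>e\<^sub>0 > 0\<close> e'(1) by (simp add: field_simps)
  have "4 / (3^3 * 7^18) * (real e\<^sub>0^6 * x) * real e'^6 \<le> 4 / (3^3 * 7^18) * (real e\<^sub>0^6 * x) * real (3 * 7^3)^6"
    using x e6 by (intro mult_left_mono) auto
  also have "\<dots> = 108 * (real e\<^sub>0^6 * x)" by simp
  finally have "4 / (3^3 * 7^18) * (real e\<^sub>0^6 * x) * real e'^6 \<le> h" using h(1) by linarith
  then have "4 / (3^3 * 7^18) * x \<le> twht (A7 a b) (B7 a b)"
    unfolding t using \<open>e\<^sub>0 > 0\<close> e'(1) by (simp add: field_simps)
  then show "2^2 / (3^3 * 7^18) * real e\<^sub>0^12 * real n\<^sub>0^6 \<le> twht (A7 a b) (B7 a b)"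
    by (simp add: x_def)
qed

theorem theorem4p2p5:
  shows "\<exists>\<kappa>\<^sub>7 :: real.
    algebraic \<kappa>\<^sub>7 \<and>
    311406871.990204 \<le> \<kappa>\<^sub>7 \<and> \<kappa>\<^sub>7 < 311406871.990205 \<and>
    (\<exists>a b :: real. C7 a b = 1 \<and> ht (A7 a b) (B7 a b) = \<kappa>\<^sub>7) \<and>
    (\<forall>a b :: real. C7 a b = 1 \<longrightarrow> ht (A7 a b) (B7 a b) \<le> \<kappa>\<^sub>7) \<and>
    (\<forall>a b :: real.
       108 * C7 a b ^ 6 \<le> ht (A7 a b) (B7 a b) \<and>
       ht (A7 a b) (B7 a b) \<le> \<kappa>\<^sub>7 * C7 a b ^ 6) \<and>
    (\<forall>(a :: int) (b :: int) (e\<^sub>0 :: nat) (n\<^sub>0 :: nat).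
       groomed7 a b \<longrightarrow> e\<^sub>0 > 0 \<longrightarrow> n\<^sub>0 > 0 \<longrightarrow> cubefree n\<^sub>0 \<longrightarrow>
       C7 a b = int e\<^sub>0 ^ 3 * int n\<^sub>0 \<longrightarrow>
         (\<exists>e' :: nat. e' > 0 \<and> e' dvd 3 * 7 ^ 3 \<and> tmd (A7 a b) (B7 a b) = e\<^sub>0 * e') \<and>
         2 ^ 2 / (3 ^ 3 * 7 ^ 18) * real e\<^sub>0 ^ 12 * real n\<^sub>0 ^ 6 \<le> twht (A7 a b) (B7 a b) \<and>
         twht (A7 a b) (B7 a b) \<le> \<kappa>\<^sub>7 * real e\<^sub>0 ^ 12 * real n\<^sub>0 ^ 6)"
proof -
  obtain \<kappa> a b :: real
    where \<kappa>: "algebraic \<kappa>" "311406871.990204 \<le> \<kappa>" "\<kappa> < 311406871.990205"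
      and ab: "C7 a b = 1" "ht (A7 a b) (B7 a b) = \<kappa>"
      and le: "\<And>a b. ht (A7 a b) (B7 a b) \<le> \<kappa> * C7 a b^6"
    by (rule ht_7_maximum) blast
  have "(\<exists>e' :: nat. e' > 0 \<and> e' dvd 3 * 7 ^ 3 \<and> tmd (A7 a b) (B7 a b) = e\<^sub>0 * e') \<and>
      2 ^ 2 / (3 ^ 3 * 7 ^ 18) * real e\<^sub>0 ^ 12 * real n\<^sub>0 ^ 6 \<le> twht (A7 a b) (B7 a b) \<and>
      twht (A7 a b) (B7 a b) \<le> \<kappa> * real e\<^sub>0 ^ 12 * real n\<^sub>0 ^ 6"
    if "groomed7 a b" "e\<^sub>0 > 0" "n\<^sub>0 > 0" "cubefree n\<^sub>0" and C: "C7 a b = int e\<^sub>0 ^ 3 * int n\<^sub>0"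
    for a b :: int and e\<^sub>0 n\<^sub>0 :: nat
  proof -
    have "coprime a b"
      using that(1) by (simp add: groomed7_def coprime_iff_gcd_eq_1)
    from tmd_7[OF this that(4,3,2) C] obtain e'
      where e': "e' > 0" "e' dvd 3 * 7^3" "tmd (A7 a b) (B7 a b) = e\<^sub>0 * e'" .
    have "\<kappa> \<ge> 0" using \<kappa>(2) by simp
    note bounds = twht_7_bounds[OF le ht_7_lower this \<open>e\<^sub>0 > 0\<close> C e']
    show ?thesis using bounds e' by blast
  qed
  then have "\<forall>(a :: int) (b :: int) (e\<^sub>0 :: nat) (n\<^sub>0 :: nat).
      groomed7 a b \<longrightarrow> e\<^sub>0 > 0 \<longrightarrow> n\<^sub>0 > 0 \<longrightarrow> cubefree n\<^sub>0 \<longrightarrow>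
      C7 a b = int e\<^sub>0 ^ 3 * int n\<^sub>0 \<longrightarrow>
        (\<exists>e' :: nat. e' > 0 \<and> e' dvd 3 * 7 ^ 3 \<and> tmd (A7 a b) (B7 a b) = e\<^sub>0 * e') \<and>
        2 ^ 2 / (3 ^ 3 * 7 ^ 18) * real e\<^sub>0 ^ 12 * real n\<^sub>0 ^ 6 \<le> twht (A7 a b) (B7 a b) \<and>
        twht (A7 a b) (B7 a b) \<le> \<kappa> * real e\<^sub>0 ^ 12 * real n\<^sub>0 ^ 6"
    by (intro allI impI)
  moreover have "\<exists>a b :: real. C7 a b = 1 \<and> ht (A7 a b) (B7 a b) = \<kappa>"
    using ab by blast
  moreover have "\<forall>a b :: real. C7 a b = 1 \<longrightarrow> ht (A7 a b) (B7 a b) \<le> \<kappa>"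
  proof (intro allI impI)
    show "ht (A7 a b) (B7 a b) \<le> \<kappa>" if "C7 a b = 1" for a b :: real
      using le[of a b] that by simp
  qed
  moreover have "\<forall>a b :: real. 108 * C7 a b ^ 6 \<le> ht (A7 a b) (B7 a b) \<and>
      ht (A7 a b) (B7 a b) \<le> \<kappa> * C7 a b ^ 6"
    using le ht_7_lower by (intro allI conjI)
  ultimately show ?thesis
    using \<kappa> by - (rule exI[of _ \<kappa>], intro conjI)
qed

end
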